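(* Let $G$ be a finitely generated group with finitely many conjugacy classes $C_1,\ldots,C_r$ and with generating set $S=\{s_1,\ldots,s_n\}$. If $G$ has an independent signature sequence (with respect to $S$), then for any two finite dimensional complex linear representations $\rho_1,\rho_2$ of $G$, $d(S,\rho_1)=d(S,\rho_2)$ implies $\chi_{\rho_1}(g)=\chi_{\rho_2}(g)$ for each $g\in G$, where $\chi_{\rho}$ denotes the character of $\rho$.
   Context: $\mathbb{N}$ includes $0$. $M(S)$ is the free monoid on the alphabet $S$, and $\phi:M(S)\to G$ is the monoid homomorphism with $\phi(s_i)=s_i$. The signature of a word $w\in M(S)$ is $\mathrm{sig}(w)=(a_1,\ldots,a_n)\in\mathbb{N}^n$, where $a_i$ is the number of occurrences of $s_i$ in $w$. For $\alpha\in\mathbb{N}^n$ let $E_\alpha=\{u\in M(S):\mathrm{sig}(u)=\alpha\}$, and let the signature vector be $V_\alpha=(|E_\alpha\cap\phi^{-1}(C_1)|,\ldots,|E_\alpha\cap\phi^{-1}(C_r)|)$. A sequence $\alpha_1,\ldots,\alpha_r\in\mathbb{N}^n$ (with $r$ the number of conjugacy classes) is an independent signature sequence (ISS) if $V_{\alpha_1},\ldots,V_{\alpha_r}$ are linearly independent. For a finite dimensional complex linear representation $\rho$ of $G$, $d(S,\rho)=\det[x_0I+x_1\rho(s_1)+\cdots+x_n\rho(s_n)]$. *)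

theory Defs
  imports
    "HOL-Algebra.Generated_Groups"
    "HOL-Library.Poly_Mapping"
    "Jordan_Normal_Form.Determinant"
    "Jordan_Normal_Form.VS_Connect"
begin

section \<open>Words, signatures, independent signature sequences\<close>

text \<open>
  The generating set \<open>S = {s\<^sub>1, \<dots>, s\<^sub>n}\<close> is given by a list \<open>ss\<close> of distinct group elements, so
  that \<open>n = length ss\<close> and \<open>s\<^sub>i = ss ! (i - 1)\<close>. The free monoid \<open>M(S)\<close> is \<open>lists (set ss)\<close>, and
  elements of \<open>\<nat>\<^sup>n\<close> are lists of naturals of length \<open>n\<close>.
\<close>

definition word_val :: "('a, 'b) monoid_scheme \<Rightarrow> 'a list \<Rightarrow> 'a" where
  "word_val G w = foldr (mult G) w (one G)"

definition signature :: "'a list \<Rightarrow> 'a list \<Rightarrow> nat list" where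
  "signature ss w = map (count_list w) ss"

definition sig_words :: "'a list \<Rightarrow> nat list \<Rightarrow> 'a list set" where
  "sig_words ss \<alpha> = {u \<in> lists (set ss). signature ss u = \<alpha>}"

definition conj_class :: "('a, 'b) monoid_scheme \<Rightarrow> 'a \<Rightarrow> 'a set" where
  "conj_class G g = {h \<otimes>\<^bsub>G\<^esub> g \<otimes>\<^bsub>G\<^esub> inv\<^bsub>G\<^esub> h | h. h \<in> carrier G}"

definition conj_classes :: "('a, 'b) monoid_scheme \<Rightarrow> 'a set set" where
  "conj_classes G = conj_class G ` carrier G"

text \<open>
  The cardinalities below are those of finite sets, since there are only finitely many words of
  given signature. The integer vectors \<open>V\<^sub>\<alpha>\<close> are regarded as elements of \<open>\<complex>\<^sup>r\<close>.
\<close>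

definition sig_vector ::
    "('a, 'b) monoid_scheme \<Rightarrow> 'a list \<Rightarrow> 'a set list \<Rightarrow> nat list \<Rightarrow> complex vec" where
  "sig_vector G ss Cs \<alpha> =
     vec (length Cs) (\<lambda>j. of_nat (card (sig_words ss \<alpha> \<inter> word_val G -` (Cs ! j))))"

text \<open>
  The library's notion of linear dependence is for sets of vectors; for a sequence,
  distinctness has to be required in addition.
\<close>

definition lin_indpt_seq :: "nat \<Rightarrow> complex vec list \<Rightarrow> bool" where
  "lin_indpt_seq r vs \<longleftrightarrow> set vs \<subseteq> carrier_vec r \<and> distinct vs \<and>
     \<not> module.lin_dep class_ring (module_vec TYPE(complex) r) (set vs)"

definition ind_sig_seq ::
    "('a, 'b) monoid_scheme \<Rightarrow> 'a list \<Rightarrow> 'a set list \<Rightarrow> nat list list \<Rightarrow> bool" where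
  "ind_sig_seq G ss Cs \<alpha>s \<longleftrightarrow>
     length \<alpha>s = length Cs \<and> (\<forall>\<alpha> \<in> set \<alpha>s. length \<alpha> = length ss) \<and>
     lin_indpt_seq (length Cs) (map (sig_vector G ss Cs) \<alpha>s)"


section \<open>Representations and the polynomial \<open>d(S, \<rho>)\<close>\<close>

definition GL :: "nat \<Rightarrow> complex mat monoid" where
  "GL m = units_of (ring_mat TYPE(complex) m ())"

text \<open>A representation of dimension \<open>m\<close>, with respect to a basis.\<close>

definition is_rep :: "('a, 'b) monoid_scheme \<Rightarrow> nat \<Rightarrow> ('a \<Rightarrow> complex mat) \<Rightarrow> bool" where
  "is_rep G m \<rho> \<longleftrightarrow> \<rho> \<in> hom G (GL m)"

definition rep_character :: "('a \<Rightarrow> complex mat) \<Rightarrow> 'a \<Rightarrow> complex" where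
  "rep_character \<rho> g = sum_list (diag_mat (\<rho> g))"

text \<open>
  Polynomials over \<open>\<complex>\<close> in variables indexed by \<open>nat\<close>: finitely supported functions from
  monomials (finitely supported exponent functions) to coefficients.
\<close>

type_synonym cpoly = "(nat \<Rightarrow>\<^sub>0 nat) \<Rightarrow>\<^sub>0 complex"

definition pvar :: "nat \<Rightarrow> cpoly" where
  "pvar i = Poly_Mapping.single (Poly_Mapping.single i 1) 1"

definition pconst :: "complex \<Rightarrow> cpoly" where
  "pconst c = Poly_Mapping.single 0 c"

text \<open>The variable attached to the generator \<open>ss ! i\<close> is \<open>x\<^sub>i\<^sub>+\<^sub>1\<close>, as \<open>x\<^sub>0\<close> belongs to the identity.\<close>

definition rep_pencil :: "'a list \<Rightarrow> nat \<Rightarrow> ('a \<Rightarrow> complex mat) \<Rightarrow> cpoly mat" where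
  "rep_pencil ss m \<rho> =
     pvar 0 \<cdot>\<^sub>m 1\<^sub>m m +
     foldr (+) (map (\<lambda>i. pvar (Suc i) \<cdot>\<^sub>m map_mat pconst (\<rho> (ss ! i))) [0..<length ss]) (0\<^sub>m m m)"

definition char_det :: "'a list \<Rightarrow> nat \<Rightarrow> ('a \<Rightarrow> complex mat) \<Rightarrow> cpoly" where
  "char_det ss m \<rho> = det (rep_pencil ss m \<rho>)"

end

theory Submission
  imports Defs "Jordan_Normal_Form.Schur_Decomposition" "Jordan_Normal_Form.DL_Rank"
begin

text \<open>
  Write \<open>X = c\<^sub>1 \<rho>(s\<^sub>1) + \<dots> + c\<^sub>n \<rho>(s\<^sub>n)\<close>. Evaluating \<open>d(S, \<rho>)\<close> at
  \<open>(x, -c\<^sub>1, \<dots>, -c\<^sub>n)\<close> gives \<open>det (x I - X)\<close>, so \<open>d(S, \<rho>)\<close> determines the characteristic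
  polynomial of \<open>X\<close> for every choice of the \<open>c\<^sub>i\<close> (lemma \<open>char_poly_gen_comb\<close>), hence the eigenvalues
  of \<open>X\<close> with multiplicity and all the power traces \<open>tr (X\<^sup>k)\<close> (lemma \<open>mat_trace_pow_cong_char_poly\<close>).

  Expanding the power turns \<open>tr (X\<^sup>k)\<close> into a sum over the words of length \<open>k\<close>, where a word \<open>w\<close>
  contributes \<open>\<chi>\<^sub>\<rho>(\<phi>(w))\<close> times a monomial in the \<open>c\<^sub>i\<close> that depends on \<open>sig(w)\<close> alone. As a
  polynomial in the \<open>c\<^sub>i\<close>, this trace thus has the coefficients
  \<open>\<Sum>w\<in>E\<^sub>\<alpha>. \<chi>\<^sub>\<rho>(\<phi>(w))\<close>, and these are therefore determined by \<open>d(S, \<rho>)\<close>. To read them off with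
  polynomials in one variable only, put \<open>c\<^sub>i = t ^ (B ^ (i - 1))\<close> with a base \<open>B\<close> exceeding \<open>k\<close>: the
  exponents that occur in \<open>\<alpha>\<close> are then the base \<open>B\<close> digits of the exponent of \<open>t\<close>, so
  different signatures give different powers of \<open>t\<close> (lemma \<open>sum_character_sig_words_eq\<close>).

  Characters are class functions, so the sum over \<open>E\<^sub>\<alpha>\<close> is the scalar product of \<open>V\<^sub>\<alpha>\<close> with the
  vector of the values of \<open>\<chi>\<^sub>\<rho>\<close> on the classes. If \<open>d(S, \<rho>\<^sub>1) = d(S, \<rho>\<^sub>2)\<close>, the vector of the
  values of \<open>\<chi>\<^sub>\<rho>\<^sub>1 - \<chi>\<^sub>\<rho>\<^sub>2\<close> is orthogonal to every \<open>V\<^sub>\<alpha>\<close>, and it vanishes because \<open>r\<close>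
  independent vectors span \<open>\<complex>\<^sup>r\<close> (lemma \<open>lin_indpt_seq_orthogonal\<close>).
\<close>


section \<open>Evaluation of polynomials in several variables\<close>

definition mono_eval :: "(nat \<Rightarrow> complex) \<Rightarrow> (nat \<Rightarrow>\<^sub>0 nat) \<Rightarrow> complex" where
  "mono_eval y m = (\<Prod>i\<in>Poly_Mapping.keys m. y i ^ Poly_Mapping.lookup m i)"

definition poly_eval :: "(nat \<Rightarrow> complex) \<Rightarrow> cpoly \<Rightarrow> complex" where
  "poly_eval y p = (\<Sum>m\<in>Poly_Mapping.keys p. Poly_Mapping.lookup p m * mono_eval y m)"

lemma mono_eval_superset:
  assumes "finite A" "Poly_Mapping.keys m \<subseteq> A"
  shows "mono_eval y m = (\<Prod>i\<in>A. y i ^ Poly_Mapping.lookup m i)"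
  unfolding mono_eval_def using assms
  by (intro prod.mono_neutral_left) (auto simp: in_keys_iff)

lemma mono_eval_0: "mono_eval y 0 = 1"
  by (simp add: mono_eval_def)

lemma mono_eval_single: "mono_eval y (Poly_Mapping.single i 1) = y i"
  by (simp add: mono_eval_def)

lemma mono_eval_add: "mono_eval y (m + m') = mono_eval y m * mono_eval y m'"
proof -
  define A where "A = Poly_Mapping.keys m \<union> Poly_Mapping.keys m'"
  have "finite A" by (simp add: A_def)
  moreover have "Poly_Mapping.keys (m + m') \<subseteq> A"
    using Poly_Mapping.keys_add[of m m'] by (simp add: A_def)
  moreover have "Poly_Mapping.keys m \<subseteq> A" "Poly_Mapping.keys m' \<subseteq> A" by (auto simp: A_def)
  ultimately show ?thesis
    by (simp add: mono_eval_superset[of A] lookup_add power_add prod.distrib)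
qed

lemma poly_eval_0: "poly_eval y 0 = 0"
  by (simp add: poly_eval_def)

lemma poly_eval_single: "poly_eval y (Poly_Mapping.single m c) = c * mono_eval y m"
  by (simp add: poly_eval_def)

lemma poly_eval_add: "poly_eval y (p + q) = poly_eval y p + poly_eval y q"
  unfolding poly_eval_def
  by (rule Poly_Mapping.setsum_keys_plus_distrib) (auto simp: algebra_simps)

lemma poly_eval_sum: "poly_eval y (\<Sum>i\<in>A. f i) = (\<Sum>i\<in>A. poly_eval y (f i))"
  by (induction A rule: infinite_finite_induct) (auto simp: poly_eval_0 poly_eval_add)

text \<open>
  Evaluation is additive, so this decomposition reduces its multiplicativity to monomials.
\<close>

lemma poly_mapping_eq_sum_single:
  fixes p :: "'a \<Rightarrow>\<^sub>0 'b :: comm_monoid_add"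
  shows "p = (\<Sum>m\<in>Poly_Mapping.keys p. Poly_Mapping.single m (Poly_Mapping.lookup p m))"
  by (rule poly_mapping_eqI) 
     (auto simp: lookup_sum lookup_single when_def in_keys_iff)

lemma poly_eval_mult: "poly_eval y (p * q) = poly_eval y p * poly_eval y q"
proof -
  have "p * q = (\<Sum>m\<in>Poly_Mapping.keys p. Poly_Mapping.single m (Poly_Mapping.lookup p m)) *
      (\<Sum>m'\<in>Poly_Mapping.keys q. Poly_Mapping.single m' (Poly_Mapping.lookup q m'))"
    using poly_mapping_eq_sum_single[of p] poly_mapping_eq_sum_single[of q] by metis
  also have "\<dots> = (\<Sum>m\<in>Poly_Mapping.keys p. \<Sum>m'\<in>Poly_Mapping.keys q.
      Poly_Mapping.single (m + m') (Poly_Mapping.lookup p m * Poly_Mapping.lookup q m'))"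
    by (simp add: sum_product mult_single)
  also have "poly_eval y \<dots> = poly_eval y p * poly_eval y q"
    unfolding poly_eval_sum poly_eval_single mono_eval_add
    by (simp add: poly_eval_def sum_product mult_ac)
  finally show ?thesis .
qed

text \<open>Being a ring homomorphism, evaluation commutes with determinants.\<close>

lemma poly_eval_hom: "comm_ring_hom (poly_eval y)"
  by unfold_locales
     (auto simp: poly_eval_0 poly_eval_add poly_eval_mult poly_eval_single mono_eval_0
           simp flip: single_one)

lemma poly_eval_pvar: "poly_eval y (pvar i) = y i"
  using mono_eval_single[of y i] by (simp add: pvar_def poly_eval_single)

lemma poly_eval_pconst: "poly_eval y (pconst c) = c"
  by (simp add: pconst_def poly_eval_single mono_eval_0)

section \<open>Traces of powers and the characteristic polynomial\<close>

definition mat_trace :: "'a :: comm_monoid_add mat \<Rightarrow> 'a" where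
  "mat_trace A = (\<Sum>i<dim_row A. A $$ (i, i))"

lemma sum_list_diag_mat: "sum_list (diag_mat A) = mat_trace A"
  by (simp add: diag_mat_def mat_trace_def interv_sum_list_conv_sum_set_nat lessThan_atLeast0)

lemma mat_trace_mult_comm:
  fixes A B :: "'a :: comm_semiring_0 mat"
  assumes "A \<in> carrier_mat n k" "B \<in> carrier_mat k n"
  shows "mat_trace (A * B) = mat_trace (B * A)"
proof -
  have "mat_trace (A * B) = (\<Sum>i<n. \<Sum>j<k. A $$ (i,j) * B $$ (j,i))"
    using assms by (auto simp: mat_trace_def scalar_prod_def lessThan_atLeast0 intro!: sum.cong)
  also have "\<dots> = (\<Sum>j<k. \<Sum>i<n. B $$ (j,i) * A $$ (i,j))"
    by (subst sum.swap) (simp add: mult.commute)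
  also have "\<dots> = mat_trace (B * A)"
    using assms by (auto simp: mat_trace_def scalar_prod_def lessThan_atLeast0 intro!: sum.cong)
  finally show ?thesis .
qed

lemma mat_trace_similar:
  fixes A :: "'a :: comm_ring_1 mat"
  assumes A: "A \<in> carrier_mat n n" and sim: "similar_mat_wit A B P Q"
  shows "mat_trace A = mat_trace B"
proof -
  note w = similar_mat_witD2[OF A sim]
  have "mat_trace A = mat_trace (P * (B * Q))"
    using w by (simp add: assoc_mult_mat[of _ n n _ n _ n])
  also have "\<dots> = mat_trace ((B * Q) * P)"
    using w by (intro mat_trace_mult_comm[of _ n n]) auto
  also have "(B * Q) * P = B"
    using w by (simp add: assoc_mult_mat[of _ n n _ n _ n])
  finally show ?thesis .
qed

text \<open>
  In row \<open>i\<close> of the product of upper triangular matrices, a diagonal entry gets a contribution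
  only from the middle index \<open>i\<close>. For the induction, the vanishing below the diagonal is needed
  together with the values on it.
\<close>

lemma upper_triangular_pow:
  fixes B :: "'a :: comm_ring_1 mat"
  assumes B: "B \<in> carrier_mat n n" and ut: "upper_triangular B"
  shows "i < n \<Longrightarrow> j < n \<Longrightarrow> j \<le> i \<Longrightarrow>
           (B ^\<^sub>m k) $$ (i, j) = (if i = j then (B $$ (i, i)) ^ k else 0)"
proof (induction k arbitrary: i j)
  case 0
  then show ?case using B by auto
next
  case (Suc k)
  have "(B ^\<^sub>m Suc k) $$ (i, j) = (\<Sum>l<n. (B ^\<^sub>m k) $$ (i, l) * B $$ (l, j))"
    using B Suc.prems by (auto simp: scalar_prod_def lessThan_atLeast0 intro!: sum.cong)
  also have "\<dots> = (\<Sum>l<n. if l = i then (if i = j then (B $$ (i, i)) ^ Suc k else 0) else 0)"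
  proof (rule sum.cong)
    fix l assume l: "l \<in> {..<n}"
    consider "l < i" | "l = i" | "l > i" by linarith
    then show "(B ^\<^sub>m k) $$ (i, l) * B $$ (l, j) =
        (if l = i then (if i = j then (B $$ (i, i)) ^ Suc k else 0) else 0)"
    proof cases
      case 1
      then show ?thesis using Suc.IH[of i l] Suc.prems l by auto
    next
      case 2
      then show ?thesis using Suc.IH[of i l] Suc.prems l upper_triangularD[OF ut, of j i] B
        by (auto simp: mult.commute)
    next
      case 3
      then show ?thesis using upper_triangularD[OF ut, of j l] Suc.prems B l by auto
    qed
  qed auto
  also have "\<dots> = (if i = j then (B $$ (i, i)) ^ Suc k else 0)"
    using Suc.prems by auto
  finally show ?case .
qed

text \<open>
  A Schur decomposition makes the matrix upper triangular with the prescribed roots on the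
  diagonal. Similarity carries over to powers and preserves the trace, and the power of a
  triangular matrix has the powers of the roots on its diagonal.
\<close>

lemma mat_trace_pow_eq_power_sum:
  fixes A :: "complex mat"
  assumes A: "A \<in> carrier_mat n n" and es: "char_poly A = (\<Prod>e\<leftarrow>es. [:- e, 1:])"
  shows "mat_trace (A ^\<^sub>m k) = (\<Sum>e\<leftarrow>es. e ^ k)"
proof -
  obtain B P Q where dec: "schur_decomposition A es = (B, P, Q)"
    by (cases "schur_decomposition A es")
  from schur_decomposition[OF A es dec] have sim: "similar_mat_wit A B P Q"
    and ut: "upper_triangular B" and diag: "diag_mat B = es" by auto
  have B: "B \<in> carrier_mat n n" using similar_mat_witD2[OF A sim] by simp
  have "mat_trace (A ^\<^sub>m k) = mat_trace (B ^\<^sub>m k)"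
    using mat_trace_similar[OF pow_carrier_mat[OF A] similar_mat_wit_pow[OF sim]] .
  also have "\<dots> = (\<Sum>i<n. (B $$ (i, i)) ^ k)"
    using B upper_triangular_pow[OF B ut] by (simp add: mat_trace_def)
  also have "\<dots> = (\<Sum>e\<leftarrow>diag_mat B. e ^ k)"
    using B by (simp add: diag_mat_def interv_sum_list_conv_sum_set_nat lessThan_atLeast0 comp_def)
  finally show ?thesis by (simp add: diag)
qed

text \<open>
  The characteristic polynomial splits over \<open>\<complex>\<close>, so both traces are the \<open>k\<close>-th power sum of its
  roots.
\<close>

lemma mat_trace_pow_cong_char_poly:
  fixes A B :: "complex mat"
  assumes "A \<in> carrier_mat n n" "B \<in> carrier_mat m m" "char_poly A = char_poly B"
  shows "mat_trace (A ^\<^sub>m k) = mat_trace (B ^\<^sub>m k)"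
proof -
  obtain es where "char_poly A = (\<Prod>e\<leftarrow>es. [:- e, 1:])"
    using char_poly_factorized[OF assms(1)] by auto
  then show ?thesis
    using mat_trace_pow_eq_power_sum[OF assms(1)] mat_trace_pow_eq_power_sum[OF assms(2)] assms(3)
    by simp
qed

section \<open>Linear combinations of the generators in a representation\<close>

lemma is_repD:
  assumes "group G" "is_rep G m \<rho>"
  shows "x \<in> carrier G \<Longrightarrow> \<rho> x \<in> carrier_mat m m"
    and "x \<in> carrier G \<Longrightarrow> y \<in> carrier G \<Longrightarrow> \<rho> (x \<otimes>\<^bsub>G\<^esub> y) = \<rho> x * \<rho> y"
    and "\<rho> \<one>\<^bsub>G\<^esub> = 1\<^sub>m m"
proof -
  have "monoid (ring_mat TYPE(complex) m ())"
    using ring_mat[of m "()"] unfolding ring_def by blast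
  then have "group (GL m)" unfolding GL_def by (rule monoid.units_group)
  moreover have hom: "\<rho> \<in> hom G (GL m)" using assms(2) by (simp add: is_rep_def)
  ultimately have "group_hom G (GL m) \<rho>"
    using assms(1) by (simp add: group_hom_def group_hom_axioms_def)
  then show "\<rho> \<one>\<^bsub>G\<^esub> = 1\<^sub>m m"
    using group_hom.hom_one by (fastforce simp: GL_def units_of_one ring_mat_simps)
  show "x \<in> carrier G \<Longrightarrow> \<rho> x \<in> carrier_mat m m"
    using hom by (auto simp: hom_def GL_def units_of_def Units_def ring_mat_simps)
  show "x \<in> carrier G \<Longrightarrow> y \<in> carrier G \<Longrightarrow> \<rho> (x \<otimes>\<^bsub>G\<^esub> y) = \<rho> x * \<rho> y"
    using hom by (auto simp: hom_def GL_def units_of_def ring_mat_simps)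
qed

lemma rep_character_conj:
  assumes G: "group G" and \<rho>: "is_rep G m \<rho>" and g: "g \<in> carrier G" and h: "h \<in> carrier G"
  shows "rep_character \<rho> (h \<otimes>\<^bsub>G\<^esub> g \<otimes>\<^bsub>G\<^esub> inv\<^bsub>G\<^esub> h) = rep_character \<rho> g"
proof -
  interpret group G by fact
  note r = is_repD[OF G \<rho>]
  have "mat_trace (\<rho> (h \<otimes>\<^bsub>G\<^esub> g \<otimes>\<^bsub>G\<^esub> inv\<^bsub>G\<^esub> h)) = mat_trace (\<rho> (h \<otimes>\<^bsub>G\<^esub> g) * \<rho> (inv\<^bsub>G\<^esub> h))"
    using g h by (simp add: r)
  also have "\<dots> = mat_trace (\<rho> (inv\<^bsub>G\<^esub> h) * \<rho> (h \<otimes>\<^bsub>G\<^esub> g))"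
    using g h by (intro mat_trace_mult_comm[of _ m m]) (auto intro: r)
  also have "\<rho> (inv\<^bsub>G\<^esub> h) * \<rho> (h \<otimes>\<^bsub>G\<^esub> g) = \<rho> (inv\<^bsub>G\<^esub> h \<otimes>\<^bsub>G\<^esub> (h \<otimes>\<^bsub>G\<^esub> g))"
    using g h by (simp add: r)
  also have "inv\<^bsub>G\<^esub> h \<otimes>\<^bsub>G\<^esub> (h \<otimes>\<^bsub>G\<^esub> g) = g" using g h by (simp flip: m_assoc)
  finally show ?thesis by (simp add: rep_character_def sum_list_diag_mat)
qed

definition gen_comb :: "'a list \<Rightarrow> nat \<Rightarrow> ('a \<Rightarrow> complex mat) \<Rightarrow> ('a \<Rightarrow> complex) \<Rightarrow> complex mat" where
  "gen_comb ss m \<rho> c = mat m m (\<lambda>(a, b). \<Sum>s\<in>set ss. c s * \<rho> s $$ (a, b))"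

lemma gen_comb_carrier [simp]: "gen_comb ss m \<rho> c \<in> carrier_mat m m"
  by (simp add: gen_comb_def)

lemma dim_row_gen_comb [simp]: "dim_row (gen_comb ss m \<rho> c) = m"
  by (simp add: gen_comb_def)

lemma foldr_add_mat:
  assumes "\<And>i. i \<in> set is \<Longrightarrow> f i \<in> carrier_mat m m"
  shows "foldr (+) (map f is) (0\<^sub>m m m) \<in> carrier_mat m m"
    and "a < m \<Longrightarrow> b < m \<Longrightarrow>
      foldr (+) (map f is) (0\<^sub>m m m) $$ (a, b) = (\<Sum>i\<leftarrow>is. f i $$ (a, b))"
  using assms by (induction "is") auto

text \<open>
  The coefficients enter with a minus sign to turn the sum \<open>x\<^sub>0 I + \<dots>\<close> in \<open>d(S, \<rho>)\<close> into the
  difference \<open>x I - X\<close> of a characteristic matrix.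
\<close>

lemma char_poly_gen_comb:
  assumes G: "group G" and \<rho>: "is_rep G m \<rho>" and ss: "distinct ss" "set ss \<subseteq> carrier G"
  shows "poly (char_poly (gen_comb ss m \<rho> c)) x =
    poly_eval (case_nat x (\<lambda>i. - c (ss ! i))) (char_det ss m \<rho>)"
proof -
  define y where "y = case_nat x (\<lambda>i. - c (ss ! i))"
  have y: "y 0 = x" "y (Suc i) = - c (ss ! i)" for i by (simp_all add: y_def)
  interpret comm_ring_hom "poly_eval y" by (rule poly_eval_hom)
  define A where "A = gen_comb ss m \<rho> c"
  define F where "F = (\<lambda>i. pvar (Suc i) \<cdot>\<^sub>m map_mat pconst (\<rho> (ss ! i)))"
  have ssc: "ss ! i \<in> carrier G" if "i < length ss" for i
    using ss(2) that by (auto simp: subset_iff)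
  have F: "F i \<in> carrier_mat m m" if "i \<in> set [0..<length ss]" for i
    using is_repD(1)[OF G \<rho> ssc] that by (simp add: F_def)
  have A: "A \<in> carrier_mat m m" by (simp add: A_def)
  have pencil: "rep_pencil ss m \<rho> =
      pvar 0 \<cdot>\<^sub>m 1\<^sub>m m + foldr (+) (map F [0..<length ss]) (0\<^sub>m m m)"
    by (simp add: rep_pencil_def F_def)
  have P: "rep_pencil ss m \<rho> \<in> carrier_mat m m"
    unfolding pencil using foldr_add_mat(1)[of "[0..<length ss]" F, OF F] by auto
  have "poly (char_poly A) x = det (map_mat (poly_eval y) (rep_pencil ss m \<rho>))"
    unfolding char_poly_def
  proof (rule poly_det_cong[of _ m])
    fix a b assume ab: "a < m" "b < m"
    have "map_mat (poly_eval y) (rep_pencil ss m \<rho>) $$ (a, b) =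
        poly_eval y (rep_pencil ss m \<rho> $$ (a, b))"
      using P ab by auto
    also have "rep_pencil ss m \<rho> $$ (a, b) = pvar 0 * (if a = b then 1 else 0) +
        (\<Sum>i<length ss. F i $$ (a, b))"
      unfolding pencil using foldr_add_mat[of "[0..<length ss]" F, OF F] ab
      by (auto simp: interv_sum_list_conv_sum_set_nat lessThan_atLeast0)
    also have "poly_eval y \<dots> = x * (if a = b then 1 else 0) +
        (\<Sum>i<length ss. poly_eval y (F i $$ (a, b)))"
      by (simp add: poly_eval_sum poly_eval_add poly_eval_mult poly_eval_pvar y poly_eval_0)
    also have "(\<Sum>i<length ss. poly_eval y (F i $$ (a, b))) =
        (\<Sum>i<length ss. - (c (ss ! i) * \<rho> (ss ! i) $$ (a, b)))"
    proof (rule sum.cong)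
      fix i assume "i \<in> {..<length ss}"
      then have "\<rho> (ss ! i) \<in> carrier_mat m m" using is_repD(1)[OF G \<rho> ssc] by simp
      then show "poly_eval y (F i $$ (a, b)) = - (c (ss ! i) * \<rho> (ss ! i) $$ (a, b))"
        using ab by (simp add: F_def poly_eval_mult poly_eval_pvar poly_eval_pconst y)
    qed simp
    also have "\<dots> = - (\<Sum>s\<in>set ss. c s * \<rho> s $$ (a, b))"
      using sum.reindex_bij_betw[OF bij_betw_nth[OF ss(1) refl refl],
          of "\<lambda>s. c s * \<rho> s $$ (a, b)"] by (simp add: sum_negf)
    finally show "poly (char_poly_matrix A $$ (a, b)) x =
        map_mat (poly_eval y) (rep_pencil ss m \<rho>) $$ (a, b)"
      using ab A by (auto simp: char_poly_matrix_def A_def gen_comb_def)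
  qed (use A P in auto)
  then show ?thesis by (simp add: char_det_def flip: A_def y_def)
qed

lemma word_val_carrier:
  assumes "group G" "set w \<subseteq> carrier G"
  shows "word_val G w \<in> carrier G"
proof -
  interpret group G by fact
  show ?thesis using assms(2) by (induction w) (auto simp: word_val_def)
qed

text \<open>
  This is the noncommutative multinomial expansion. The induction splits off the first letter of
  a word, because \<open>word_val\<close> multiplies from the right end; accordingly \<open>X\<^sup>k\<^sup>+\<^sup>1\<close> is read as
  \<open>X X\<^sup>k\<close>.
\<close>

lemma gen_comb_pow:
  assumes G: "group G" and \<rho>: "is_rep G m \<rho>" and ss: "set ss \<subseteq> carrier G"
    and "a < m" "b < m"
  shows "(gen_comb ss m \<rho> c ^\<^sub>m k) $$ (a, b) =
    (\<Sum>w | set w \<subseteq> set ss \<and> length w = k. prod_list (map c w) * \<rho> (word_val G w) $$ (a, b))"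
  using assms(4,5)
proof (induction k arbitrary: a b)
  case 0
  have "{w. set w \<subseteq> set ss \<and> length w = 0} = {[]}" by auto
  with 0 show ?case by (simp add: word_val_def is_repD(3)[OF G \<rho>] gen_comb_def)
next
  case (Suc k)
  define A where "A = gen_comb ss m \<rho> c"
  define W where "W = {w. set w \<subseteq> set ss \<and> length w = k}"
  have A: "A \<in> carrier_mat m m" by (simp add: A_def)
  have Wc: "word_val G w \<in> carrier G" if "w \<in> W" for w
    using that ss by (intro word_val_carrier[OF G]) (auto simp: W_def)
  have "A ^\<^sub>m Suc k = A * A ^\<^sub>m k"
  proof (induction k)
    case (Suc k)
    then show ?case using A by (simp add: assoc_mult_mat[of _ m m _ m _ m])
  qed (use A in simp)
  then have "(A ^\<^sub>m Suc k) $$ (a, b) = (\<Sum>l<m. A $$ (a, l) * (A ^\<^sub>m k) $$ (l, b))"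
    using A Suc.prems by (auto simp: scalar_prod_def lessThan_atLeast0 intro!: sum.cong)
  also have "\<dots> = (\<Sum>l<m. (\<Sum>s\<in>set ss. c s * \<rho> s $$ (a, l)) *
      (\<Sum>w\<in>W. prod_list (map c w) * \<rho> (word_val G w) $$ (l, b)))"
    using Suc.IH Suc.prems by (intro sum.cong) (auto simp: A_def W_def gen_comb_def)
  also have "\<dots> = (\<Sum>l<m. \<Sum>w\<in>W. \<Sum>s\<in>set ss. c s * prod_list (map c w) *
      (\<rho> s $$ (a, l) * \<rho> (word_val G w) $$ (l, b)))"
    by (subst sum.swap) (simp add: sum_product mult_ac)
  also have "\<dots> = (\<Sum>w\<in>W. \<Sum>s\<in>set ss. \<Sum>l<m. c s * prod_list (map c w) *
      (\<rho> s $$ (a, l) * \<rho> (word_val G w) $$ (l, b)))"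
    by (subst sum.swap, rule sum.cong[OF refl], subst sum.swap) simp
  also have "\<dots> = (\<Sum>w\<in>W. \<Sum>s\<in>set ss. prod_list (map c (s # w)) *
      \<rho> (word_val G (s # w)) $$ (a, b))"
  proof (intro sum.cong refl)
    fix w s assume w: "w \<in> W" and s: "s \<in> set ss"
    have s': "s \<in> carrier G" using s ss by auto
    have "\<rho> (word_val G (s # w)) = \<rho> s * \<rho> (word_val G w)"
      using is_repD(2)[OF G \<rho> s' Wc[OF w]] by (simp add: word_val_def)
    moreover have "(\<rho> s * \<rho> (word_val G w)) $$ (a, b) =
        (\<Sum>l<m. \<rho> s $$ (a, l) * \<rho> (word_val G w) $$ (l, b))"
      using is_repD(1)[OF G \<rho> s'] is_repD(1)[OF G \<rho> Wc[OF w]] Suc.prems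
      by (auto simp: scalar_prod_def lessThan_atLeast0 intro!: sum.cong)
    ultimately show "(\<Sum>l<m. c s * prod_list (map c w) *
          (\<rho> s $$ (a, l) * \<rho> (word_val G w) $$ (l, b))) =
        prod_list (map c (s # w)) * \<rho> (word_val G (s # w)) $$ (a, b)"
      by (simp add: sum_distrib_left)
  qed
  also have "\<dots> = (\<Sum>w | set w \<subseteq> set ss \<and> length w = Suc k.
      prod_list (map c w) * \<rho> (word_val G w) $$ (a, b))"
    unfolding lists_length_Suc_eq W_def[symmetric] sum.cartesian_product
    by (subst sum.reindex) (auto simp: inj_on_def case_prod_unfold)
  finally show ?case by (simp add: A_def)
qed

lemma mat_trace_gen_comb_pow:
  assumes G: "group G" and \<rho>: "is_rep G m \<rho>" and ss: "set ss \<subseteq> carrier G"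
  shows "mat_trace (gen_comb ss m \<rho> c ^\<^sub>m k) =
    (\<Sum>w | set w \<subseteq> set ss \<and> length w = k. prod_list (map c w) * rep_character \<rho> (word_val G w))"
proof -
  have tr: "rep_character \<rho> (word_val G w) = (\<Sum>a<m. \<rho> (word_val G w) $$ (a, a))"
    if "set w \<subseteq> set ss" for w
  proof -
    have "\<rho> (word_val G w) \<in> carrier_mat m m"
      using that ss by (intro is_repD(1)[OF G \<rho>] word_val_carrier[OF G]) auto
    then show ?thesis by (simp add: rep_character_def sum_list_diag_mat mat_trace_def)
  qed
  have "mat_trace (gen_comb ss m \<rho> c ^\<^sub>m k) =
    (\<Sum>a<m. \<Sum>w | set w \<subseteq> set ss \<and> length w = k.
        prod_list (map c w) * \<rho> (word_val G w) $$ (a, a))"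
    by (simp add: mat_trace_def gen_comb_pow[OF G \<rho> ss] )
  also have "\<dots> = (\<Sum>w | set w \<subseteq> set ss \<and> length w = k.
        prod_list (map c w) * rep_character \<rho> (word_val G w))"
    by (subst sum.swap) (auto simp: tr sum_distrib_left intro!: sum.cong)
  finally show ?thesis .
qed

lemma sum_list_signature:
  assumes "distinct ss" "set w \<subseteq> set ss"
  shows "sum_list (signature ss w) = length w"
  using sum_count_set[OF assms(2)] assms(1)
  by (simp add: signature_def sum_list_distinct_conv_sum_set)

lemma finite_sig_words:
  assumes "distinct ss" shows "finite (sig_words ss \<alpha>)"
proof (rule finite_subset)
  show "sig_words ss \<alpha> \<subseteq> {w. set w \<subseteq> set ss \<and> length w = sum_list \<alpha>}"
    using sum_list_signature[OF assms] by (auto simp: sig_words_def subset_iff)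
qed (rule finite_lists_length_eq, simp)


section \<open>Separating signatures by Kronecker substitution\<close>

text \<open>
  The number with base \<open>B\<close> digits \<open>\<alpha>\<close>, least significant digit first. For digits below \<open>B\<close> it
  determines \<open>\<alpha>\<close> once the length is known.
\<close>

fun digit_code :: "nat \<Rightarrow> nat list \<Rightarrow> nat" where
  "digit_code B [] = 0"
| "digit_code B (a # as) = a + B * digit_code B as"

lemma digit_code_inj:
  assumes "length \<alpha> = length \<beta>" "\<forall>a\<in>set \<alpha>. a < B" "\<forall>b\<in>set \<beta>. b < B"
    and "digit_code B \<alpha> = digit_code B \<beta>"
  shows "\<alpha> = \<beta>"
  using assms
proof (induction \<alpha> \<beta> rule: list_induct2)
  case (Cons a \<alpha> b \<beta>)
  have "(a + B * digit_code B \<alpha>) mod B = (b + B * digit_code B \<beta>) mod B"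
    "(a + B * digit_code B \<alpha>) div B = (b + B * digit_code B \<beta>) div B"
    using Cons.prems by simp_all
  then have "a = b" "digit_code B \<alpha> = digit_code B \<beta>"
    using Cons.prems by auto
  then show ?case using Cons by simp
qed simp

text \<open>
  The weight of the letter \<open>ss ! i\<close> is \<open>B ^ i\<close>, the code of the \<open>i\<close>-th unit vector. Hence the
  total weight of a word is the code of its signature, and substituting \<open>t ^ B ^ i\<close> for the
  coefficient of that letter turns the monomial of a word into \<open>t\<close> to the code of its signature.
\<close>

fun var_weight :: "nat \<Rightarrow> 'a list \<Rightarrow> 'a \<Rightarrow> nat" where
  "var_weight B [] s = 0"
| "var_weight B (r # rs) s = (if s = r then 1 else B * var_weight B rs s)"

lemma digit_code_zero: "digit_code B (map (\<lambda>_. 0) rs) = 0"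
  by (induction rs) auto

lemma digit_code_add:
  "digit_code B (map (\<lambda>s. f s + g s) rs) = digit_code B (map f rs) + digit_code B (map g rs)"
  by (induction rs) (auto simp: algebra_simps)

lemma digit_code_unit:
  assumes "distinct rs"
  shows "digit_code B (map (\<lambda>r. if s = r then 1 else 0) rs) = var_weight B rs s"
  using assms
proof (induction rs)
  case (Cons r rs)
  have "map (\<lambda>r'. if r = r' then 1 else 0 :: nat) rs = map (\<lambda>_. 0) rs"
    using Cons.prems by auto
  then show ?case using Cons by (auto simp: digit_code_zero simp del: map_eq_conv)
qed simp

lemma digit_code_signature:
  fixes ss :: "'a list"
  assumes "distinct ss"
  shows "digit_code B (signature ss w) = sum_list (map (var_weight B ss) w)"
proof (induction w)
  case Nil
  have "count_list [] = (\<lambda>_ :: 'a. 0)" by auto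
  then show ?case by (simp add: signature_def digit_code_zero)
next
  case (Cons s w)
  have "signature ss (s # w) = map (\<lambda>r. (if s = r then 1 else 0) + count_list w r) ss"
    by (simp add: signature_def)
  then show ?case
    using Cons by (simp only: digit_code_add digit_code_unit[OF assms])
      (simp add: signature_def comp_def)
qed

lemma prod_list_power: "prod_list (map (\<lambda>s. (t :: 'a :: monoid_mult) ^ f s) w) = t ^ sum_list (map f w)"
  by (induction w) (auto simp: power_add)

text \<open>
  For each complex \<open>t\<close>, substitute \<open>t\<close> to the weight of a letter for its coefficient. The
  difference of the two \<open>k\<close>-th power traces is then the value at \<open>t\<close> of a polynomial \<open>p\<close> in one
  variable. It vanishes everywhere, so all its coefficients are \<open>0\<close>; the one at the code of \<open>\<alpha>\<close>
  is the difference of the two sums.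
\<close>

lemma sum_character_sig_words_eq:
  assumes G: "group G" and ss: "distinct ss" "set ss \<subseteq> carrier G"
    and \<rho>\<^sub>1: "is_rep G m\<^sub>1 \<rho>\<^sub>1" and \<rho>\<^sub>2: "is_rep G m\<^sub>2 \<rho>\<^sub>2"
    and d: "char_det ss m\<^sub>1 \<rho>\<^sub>1 = char_det ss m\<^sub>2 \<rho>\<^sub>2"
    and \<alpha>: "length \<alpha> = length ss"
  shows "(\<Sum>w\<in>sig_words ss \<alpha>. rep_character \<rho>\<^sub>1 (word_val G w)) =
    (\<Sum>w\<in>sig_words ss \<alpha>. rep_character \<rho>\<^sub>2 (word_val G w))"
proof -
  \<comment> \<open>All words of signature \<open>\<alpha>\<close> have this length. No letter occurs more often than this in
    such a word, so that base \<open>k + 1\<close> suffices.\<close>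
  define k where "k = sum_list \<alpha>"
  define W where "W = {w. set w \<subseteq> set ss \<and> length w = k}"
  define N where "N = (\<lambda>w. digit_code (Suc k) (signature ss w))"
  define f where "f = (\<lambda>w. rep_character \<rho>\<^sub>1 (word_val G w) - rep_character \<rho>\<^sub>2 (word_val G w))"
  define p where "p = (\<Sum>w\<in>W. monom (f w) (N w))"
  have finW: "finite W" unfolding W_def by (rule finite_lists_length_eq) simp
  have "poly p t = 0" for t
  proof -
    define c where "c = (\<lambda>s. t ^ var_weight (Suc k) ss s)"
    have c: "prod_list (map c w) = t ^ N w" for w
      by (simp add: c_def prod_list_power N_def digit_code_signature[OF ss(1)])
    have "char_poly (gen_comb ss m\<^sub>1 \<rho>\<^sub>1 c) = char_poly (gen_comb ss m\<^sub>2 \<rho>\<^sub>2 c)"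
      using char_poly_gen_comb[OF G \<rho>\<^sub>1 ss] char_poly_gen_comb[OF G \<rho>\<^sub>2 ss] d
      by (simp add: fun_eq_iff flip: poly_eq_poly_eq_iff)
    then have "mat_trace (gen_comb ss m\<^sub>1 \<rho>\<^sub>1 c ^\<^sub>m k) = mat_trace (gen_comb ss m\<^sub>2 \<rho>\<^sub>2 c ^\<^sub>m k)"
      by (rule mat_trace_pow_cong_char_poly[OF gen_comb_carrier gen_comb_carrier])
    then show ?thesis
      by (simp add: mat_trace_gen_comb_pow[OF G \<rho>\<^sub>1 ss(2)] mat_trace_gen_comb_pow[OF G \<rho>\<^sub>2 ss(2)]
          c p_def poly_sum poly_monom f_def W_def[symmetric] algebra_simps sum_subtractf)
  qed
  then have "p = 0" using poly_all_0_iff_0 by blast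
  then have "0 = coeff p (digit_code (Suc k) \<alpha>)" by simp
  also have "\<dots> = (\<Sum>w\<in>W. if N w = digit_code (Suc k) \<alpha> then f w else 0)"
    by (simp add: p_def coeff_sum)
  also have "\<dots> = (\<Sum>w\<in>{w \<in> W. N w = digit_code (Suc k) \<alpha>}. f w)"
    using finW by (simp add: sum.inter_filter)
  also have "{w \<in> W. N w = digit_code (Suc k) \<alpha>} = sig_words ss \<alpha>"
  proof (intro equalityI subsetI)
    fix w assume w: "w \<in> {w \<in> W. N w = digit_code (Suc k) \<alpha>}"
    then have wss: "set w \<subseteq> set ss" and "sum_list (signature ss w) = k"
      using sum_list_signature[OF ss(1)] by (auto simp: W_def)
    have "signature ss w = \<alpha>"
    proof (rule digit_code_inj)
      show "\<forall>a\<in>set (signature ss w). a < Suc k"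
        using \<open>sum_list (signature ss w) = k\<close> member_le_sum_list[of _ "signature ss w"]
        by (auto simp: less_Suc_eq_le)
      show "\<forall>b\<in>set \<alpha>. b < Suc k"
        using member_le_sum_list[of _ \<alpha>] by (auto simp: k_def le_imp_less_Suc)
    qed (use w \<alpha> in \<open>auto simp: N_def signature_def\<close>)
    with wss show "w \<in> sig_words ss \<alpha>" by (auto simp: sig_words_def)
  next
    fix w assume "w \<in> sig_words ss \<alpha>"
    then show "w \<in> {w \<in> W. N w = digit_code (Suc k) \<alpha>}"
      using sum_list_signature[OF ss(1), of w] by (auto simp: sig_words_def W_def N_def k_def subset_iff)
  qed
  finally show ?thesis by (simp add: f_def sum_subtractf)
qed

section \<open>Class functions and signature vectors\<close>

lemma mem_conj_class_self:
  assumes "group G" "g \<in> carrier G" shows "g \<in> conj_class G g"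
proof -
  interpret group G by fact
  have "g = \<one>\<^bsub>G\<^esub> \<otimes>\<^bsub>G\<^esub> g \<otimes>\<^bsub>G\<^esub> inv\<^bsub>G\<^esub> \<one>\<^bsub>G\<^esub>" using assms(2) by simp
  then show ?thesis unfolding conj_class_def by blast
qed

lemma conj_class_eqI:
  assumes "group G" "g \<in> carrier G" "x \<in> conj_class G g"
  shows "conj_class G x = conj_class G g"
proof -
  interpret group G by fact
  obtain h where h: "h \<in> carrier G" and x: "x = h \<otimes>\<^bsub>G\<^esub> g \<otimes>\<^bsub>G\<^esub> inv\<^bsub>G\<^esub> h"
    using assms(3) by (auto simp: conj_class_def)
  have 1: "k \<otimes>\<^bsub>G\<^esub> x \<otimes>\<^bsub>G\<^esub> inv\<^bsub>G\<^esub> k = (k \<otimes>\<^bsub>G\<^esub> h) \<otimes>\<^bsub>G\<^esub> g \<otimes>\<^bsub>G\<^esub> inv\<^bsub>G\<^esub> (k \<otimes>\<^bsub>G\<^esub> h)"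
    if "k \<in> carrier G" for k
    using that h assms(2) by (simp add: x m_assoc inv_mult_group)
  have 2: "k \<otimes>\<^bsub>G\<^esub> g \<otimes>\<^bsub>G\<^esub> inv\<^bsub>G\<^esub> k =
      (k \<otimes>\<^bsub>G\<^esub> inv\<^bsub>G\<^esub> h) \<otimes>\<^bsub>G\<^esub> x \<otimes>\<^bsub>G\<^esub> inv\<^bsub>G\<^esub> (k \<otimes>\<^bsub>G\<^esub> inv\<^bsub>G\<^esub> h)"
    if "k \<in> carrier G" for k
    using that h assms(2) by (subst 1) (simp_all add: m_assoc)
  show ?thesis
  proof (intro equalityI subsetI)
    fix z assume "z \<in> conj_class G x"
    then show "z \<in> conj_class G g" using 1 h unfolding conj_class_def by blast
  next
    fix z assume "z \<in> conj_class G g"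
    then show "z \<in> conj_class G x" using 2 h unfolding conj_class_def
      by (smt (verit) inv_closed m_closed mem_Collect_eq)
  qed
qed

text \<open>
  Group the words of signature \<open>\<alpha>\<close> by the conjugacy class of their value. The entries of
  \<open>V\<^sub>\<alpha>\<close> are the sizes of the groups, and the summand is constant on each.
\<close>

lemma sum_sig_words_class_function:
  assumes G: "group G" and ss: "distinct ss" "set ss \<subseteq> carrier G"
    and Cs: "distinct Cs" "set Cs = conj_classes G"
    and f: "\<And>j g. j < length Cs \<Longrightarrow> g \<in> Cs ! j \<Longrightarrow> f g = v $ j"
    and v: "v \<in> carrier_vec (length Cs)"
  shows "(\<Sum>w\<in>sig_words ss \<alpha>. f (word_val G w)) = sig_vector G ss Cs \<alpha> \<bullet> v"
proof -
  define E where "E = sig_words ss \<alpha>"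
  define K where "K = (\<lambda>j. {w \<in> E. word_val G w \<in> Cs ! j})"
  have fin: "finite E" unfolding E_def by (rule finite_sig_words[OF ss(1)])
  have wc: "word_val G w \<in> carrier G" if "w \<in> E" for w
    using that ss(2) by (intro word_val_carrier[OF G]) (auto simp: E_def sig_words_def)
  have class_of: "Cs ! j = conj_class G g" if "j < length Cs" "g \<in> Cs ! j" for j g
  proof -
    have "Cs ! j \<in> conj_classes G" using that(1) Cs(2) nth_mem by blast
    then obtain h where "h \<in> carrier G" "Cs ! j = conj_class G h"
      by (auto simp: conj_classes_def)
    then show ?thesis using conj_class_eqI[OF G, of h g] that(2) by simp
  qed
  have cover: "E = (\<Union>j<length Cs. K j)"
  proof (intro equalityI subsetI)
    fix w assume w: "w \<in> E"
    then have "conj_class G (word_val G w) \<in> set Cs"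
      using wc Cs(2) by (auto simp: conj_classes_def)
    then obtain j where "j < length Cs" "Cs ! j = conj_class G (word_val G w)"
      by (auto simp: in_set_conv_nth)
    then show "w \<in> (\<Union>j<length Cs. K j)"
      using w mem_conj_class_self[OF G wc[OF w]] by (auto simp: K_def)
  qed (auto simp: K_def)
  have disj: "K i \<inter> K j = {}" if "i < length Cs" "j < length Cs" "i \<noteq> j" for i j
  proof -
    have False if "w \<in> K i \<inter> K j" for w
      using that class_of \<open>i < _\<close> \<open>j < _\<close> \<open>i \<noteq> j\<close> Cs(1) nth_eq_iff_index_eq
      by (metis (mono_tags, lifting) IntD1 IntD2 K_def mem_Collect_eq)
    then show ?thesis by blast
  qed
  have "(\<Sum>w\<in>E. f (word_val G w)) = (\<Sum>j<length Cs. \<Sum>w\<in>K j. f (word_val G w))"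
    unfolding cover by (rule sum.UNION_disjoint) (use fin disj in \<open>auto simp: K_def\<close>)
  also have "\<dots> = (\<Sum>j<length Cs. of_nat (card (K j)) * v $ j)"
    by (intro sum.cong) (auto simp: K_def f)
  also have "\<dots> = sig_vector G ss Cs \<alpha> \<bullet> v"
    using v by (auto simp: scalar_prod_def sig_vector_def lessThan_atLeast0 K_def E_def
        Int_def intro!: sum.cong)
  finally show ?thesis by (simp add: E_def)
qed

text \<open>
  The square matrix with rows \<open>vs\<close> has full rank, so its kernel is trivial. The scalar product
  here is the bilinear one, without complex conjugation.
\<close>

lemma lin_indpt_seq_orthogonal:
  assumes "lin_indpt_seq r vs" "length vs = r" "v \<in> carrier_vec r"
    and orth: "\<And>u. u \<in> set vs \<Longrightarrow> u \<bullet> v = 0"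
  shows "v = 0\<^sub>v r"
proof -
  interpret vec_space "TYPE(complex)" r .
  define A where "A = mat_of_cols r vs"
  have vs: "set vs \<subseteq> carrier_vec r" "distinct vs" "lin_indpt (set vs)"
    using assms(1) by (auto simp: lin_indpt_seq_def)
  have A: "A \<in> carrier_mat r r" using assms(2) by (auto simp: A_def)
  have cols: "cols A = vs" using vs(1) by (simp add: A_def)
  have "rank A = r" using lin_indpt_full_rank[OF A] vs by (simp add: cols)
  then have "det A\<^sup>T \<noteq> 0" using det_rank_iff[OF A] det_transpose[OF A] by simp
  moreover have "A\<^sup>T *\<^sub>v v = 0\<^sub>v r"
  proof (rule eq_vecI)
    fix i assume i: "i < dim_vec (0\<^sub>v r)"
    then have "col A i = vs ! i" using cols_nth[of i A] cols A by simp
    then show "(A\<^sup>T *\<^sub>v v) $ i = 0\<^sub>v r $ i" using i A assms(2) orth by simp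
  qed (use A in simp)
  ultimately show ?thesis
    using det_0_iff_vec_prod_zero_field[of "A\<^sup>T" r] A assms(3) by auto
qed

section \<open>The determinant polynomial determines the character\<close>

theorem proposition3p4:
  fixes G :: "('a, 'b) monoid_scheme"
    and ss :: "'a list"
    and Cs :: "'a set list"
    and m\<^sub>1 m\<^sub>2 :: nat
    and \<rho>\<^sub>1 \<rho>\<^sub>2 :: "'a \<Rightarrow> complex mat"
  assumes "group G"
    and "distinct ss" and "set ss \<subseteq> carrier G" and "generate G (set ss) = carrier G"
    and "distinct Cs" and "set Cs = conj_classes G"
    and "\<exists>\<alpha>s. ind_sig_seq G ss Cs \<alpha>s"
    and "is_rep G m\<^sub>1 \<rho>\<^sub>1" and "is_rep G m\<^sub>2 \<rho>\<^sub>2"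
    and "char_det ss m\<^sub>1 \<rho>\<^sub>1 = char_det ss m\<^sub>2 \<rho>\<^sub>2"
  shows "\<forall>g \<in> carrier G. rep_character \<rho>\<^sub>1 g = rep_character \<rho>\<^sub>2 g"
proof
  fix g assume g: "g \<in> carrier G"
  obtain \<alpha>s where \<alpha>s: "ind_sig_seq G ss Cs \<alpha>s" using assms(7) by blast
  define f where "f = (\<lambda>g. rep_character \<rho>\<^sub>1 g - rep_character \<rho>\<^sub>2 g)"
  have f_conj: "f x = f h" if "h \<in> carrier G" "x \<in> conj_class G h" for x h
    using that rep_character_conj[OF assms(1,8)] rep_character_conj[OF assms(1,9)]
    by (auto simp: f_def conj_class_def)
  \<comment> \<open>The values of \<open>f\<close> on the classes, taken at arbitrary representatives.\<close>
  define v where "v = vec (length Cs) (\<lambda>j. f (SOME x. x \<in> Cs ! j))"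
  have v: "v \<in> carrier_vec (length Cs)" by (simp add: v_def)
  have fv: "f x = v $ j" if "j < length Cs" "x \<in> Cs ! j" for j x
  proof -
    have "Cs ! j \<in> conj_classes G" using that(1) assms(6) nth_mem by blast
    then obtain h where "h \<in> carrier G" "Cs ! j = conj_class G h"
      by (auto simp: conj_classes_def)
    moreover have "(SOME x. x \<in> Cs ! j) \<in> Cs ! j" using that(2) by (rule someI)
    ultimately show ?thesis using that f_conj by (simp add: v_def)
  qed
  have "v = 0\<^sub>v (length Cs)"
  proof (rule lin_indpt_seq_orthogonal)
    show "lin_indpt_seq (length Cs) (map (sig_vector G ss Cs) \<alpha>s)"
      "length (map (sig_vector G ss Cs) \<alpha>s) = length Cs"
      using \<alpha>s by (simp_all add: ind_sig_seq_def)
    fix u assume "u \<in> set (map (sig_vector G ss Cs) \<alpha>s)"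
    then obtain \<alpha> where u: "u = sig_vector G ss Cs \<alpha>" and "length \<alpha> = length ss"
      using \<alpha>s by (auto simp: ind_sig_seq_def)
    then have "(\<Sum>w\<in>sig_words ss \<alpha>. f (word_val G w)) = 0"
      using sum_character_sig_words_eq[OF assms(1-3,8-10)] by (simp add: f_def sum_subtractf)
    then show "u \<bullet> v = 0"
      using sum_sig_words_class_function[where f = f, OF assms(1-3,5,6) fv v] u by simp
  qed (rule v)
  moreover obtain j where j: "j < length Cs" "Cs ! j = conj_class G g"
    using g assms(6) by (metis conj_classes_def imageI in_set_conv_nth)
  ultimately have "f g = 0"
    using fv[OF j(1)] mem_conj_class_self[OF assms(1) g] by simp
  then show "rep_character \<rho>\<^sub>1 g = rep_character \<rho>\<^sub>2 g" by (simp add: f_def)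
qed

end
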